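(* Let $\mathcal{H}=\mathrm{L}(l,h,w,y)$ be a minimum distance diagram (of some $2$--Cayley digraph) and let $m\geq 1$ be an integer. Then: (a) $m\mathcal{H}=\mathrm{L}(ml,mh,mw,my)$ is a minimum distance diagram (of some $2$--Cayley digraph); (b) if $m$ divides $\gcd(l,h,w,y)$, then $\mathcal{H}/m=\mathrm{L}(l/m,h/m,w/m,y/m)$ is a minimum distance diagram (of some $2$--Cayley digraph).
   Context: A $2$--Cayley digraph is $\mathrm{Cay}(\mathrm{G},\{a,b\})$, where $\mathrm{G}$ is a finite Abelian group and $a,b\in\mathrm{G}\setminus\{0\}$ generate $\mathrm{G}$. Its vertex set is $\mathrm{G}$ and its arcs are $g\to g+a$ and $g\to g+b$ for $g\in\mathrm{G}$. A minimum distance diagram of $\mathrm{Cay}(\mathrm{G},\{a,b\})$ is a map $\psi:\mathrm{G}\to\mathbb{N}^2$ such that (i) for each $\eta\in\mathrm{G}$, $\psi(\eta)=(i,j)$ satisfies $ia+jb=\eta$ and $i+j$ is minimum among all $(i,j)\in\mathbb{N}^2$ with $ia+jb=\eta$; (ii) for every $\eta\in\mathrm{G}$ and every $(s,t)\in\mathbb{N}^2$ coordinatewise smaller than or equal to $\psi(\eta)$, there is $\gamma\in\mathrm{G}$ with $\psi(\gamma)=(s,t)$. For integers $0\leq w<l$, $0\leq y<h$, the L-shape $\mathrm{L}(l,h,w,y)$ is the set $\{(i,j)\in\mathbb{Z}^2:0\le i<l,\,0\le j<h\}\setminus\{(i,j): l-w\le i<l,\ h-y\le j<h\}$, of area $lh-wy$.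 We say $\mathrm{L}(l,h,w,y)$ is a minimum distance diagram (of $\mathrm{Cay}(\mathrm{G},\{a,b\})$) if it equals $\psi(\mathrm{G})$ for some minimum distance diagram $\psi$ of that digraph.
   Formalization: In (b) the case l = h = m (which forces w = y = 0) is excluded: there H/m = L(1,1,0,0) would need the trivial group, which has no nonzero generators, although L(m,m,0,0) with m ≥ 2 is a minimum distance diagram of Z_m × Z_m. *)

theory Defs
  imports "HOL-Algebra.Generated_Groups"
begin

text \<open>
  The Abelian group is written multiplicatively, so \<open>i a + j b\<close> becomes
  \<open>a [^] i \<otimes> b [^] j\<close>. The case \<open>a = b\<close> is allowed.
\<close>

locale two_cayley_digraph = comm_group G for G (structure) +
  fixes a b
  assumes finite_carrier: "finite (carrier G)"
    and a_in: "a \<in> carrier G - {\<one>}"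
    and b_in: "b \<in> carrier G - {\<one>}"
    and generates: "generate G {a, b} = carrier G"

definition min_dist_diagram ::
    "('g, 'x) monoid_scheme \<Rightarrow> 'g \<Rightarrow> 'g \<Rightarrow> ('g \<Rightarrow> nat \<times> nat) \<Rightarrow> bool" where
  "min_dist_diagram G a b \<psi> \<longleftrightarrow>
     (\<forall>\<eta>\<in>carrier G. \<exists>i j. \<psi> \<eta> = (i, j) \<and> a [^]\<^bsub>G\<^esub> i \<otimes>\<^bsub>G\<^esub> b [^]\<^bsub>G\<^esub> j = \<eta> \<and>
        (\<forall>i' j'. a [^]\<^bsub>G\<^esub> (i'::nat) \<otimes>\<^bsub>G\<^esub> b [^]\<^bsub>G\<^esub> (j'::nat) = \<eta> \<longrightarrow> i + j \<le> i' + j')) \<and>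
     (\<forall>\<eta>\<in>carrier G. \<forall>s t. s \<le> fst (\<psi> \<eta>) \<and> t \<le> snd (\<psi> \<eta>) \<longrightarrow>
        (\<exists>\<gamma>\<in>carrier G. \<psi> \<gamma> = (s, t)))"

text \<open>Only used for \<open>w < l\<close> and \<open>y < h\<close>, where the subtractions do not truncate.\<close>

definition L_shape :: "nat \<Rightarrow> nat \<Rightarrow> nat \<Rightarrow> nat \<Rightarrow> (nat \<times> nat) set" where
  "L_shape l h w y =
     {(i, j). i < l \<and> j < h} - {(i, j). l - w \<le> i \<and> i < l \<and> h - y \<le> j \<and> j < h}"

definition is_mdd_of ::
    "(nat \<times> nat) set \<Rightarrow> ('g, 'x) monoid_scheme \<Rightarrow> 'g \<Rightarrow> 'g \<Rightarrow> bool" where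
  "is_mdd_of S G a b \<longleftrightarrow>
     two_cayley_digraph G a b \<and> (\<exists>\<psi>. min_dist_diagram G a b \<psi> \<and> S = \<psi> ` carrier G)"

text \<open>
  Every finite group is isomorphic to one whose carrier is a set of natural numbers, so
  quantifying over groups with elements of type \<^typ>\<open>nat\<close> loses no digraph.
\<close>

definition is_mdd :: "(nat \<times> nat) set \<Rightarrow> bool" where
  "is_mdd S \<longleftrightarrow> (\<exists>(G :: nat monoid) a b. is_mdd_of S G a b)"

text \<open>
  As the generators are not the identity, a group has at least two elements, and the unit
  square is never a minimum distance diagram. It does arise as a quotient
  \<open>L_shape l h w y / m\<close>, namely for \<open>l = h = m\<close> and \<open>w = y = 0\<close> (for example from
  the four-element square belonging to the product of two groups of order two), so this
  case has to be excluded when dividing.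
\<close>

lemma unit_square_not_mdd_of: "\<not> is_mdd_of (L_shape 1 1 0 0) G a b"
proof
  assume "is_mdd_of (L_shape 1 1 0 0) G a b"
  then obtain \<psi> where G: "two_cayley_digraph G a b" and mdd: "min_dist_diagram G a b \<psi>"
    and im: "L_shape 1 1 0 0 = \<psi> ` carrier G"
    unfolding is_mdd_of_def by blast
  interpret two_cayley_digraph G a b by (fact G)
  have "\<psi> a \<in> L_shape 1 1 0 0"
    using im a_in by blast
  then have "\<psi> a = (0, 0)"
    by (auto simp: L_shape_def)
  moreover have "\<exists>i j. \<psi> a = (i, j) \<and> a [^]\<^bsub>G\<^esub> i \<otimes>\<^bsub>G\<^esub> b [^]\<^bsub>G\<^esub> j = a"
    using mdd a_in unfolding min_dist_diagram_def by blast
  ultimately have "a = \<one>\<^bsub>G\<^esub>"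
    by auto
  with a_in show False
    by simp
qed

end

theory Submission
  imports Defs "HOL-Algebra.Elementary_Groups" "HOL-Algebra.Multiplicative_Group" "HOL-Algebra.Weak_Morphisms"
begin

text \<open>
  If \<open>w\<close> or \<open>y\<close> vanishes, the L-shape is a rectangle, and every rectangle other than the unit
  square is a minimum distance diagram. Otherwise the lattice of relations between \<open>a\<close> and \<open>b\<close>
  contains \<open>(l - w, h - y)\<close>, the inner corner, and \<open>(l, -t)\<close> for some \<open>t\<close> with
  \<open>y \<le> t \<le> l\<close>, and symmetrically for \<open>h\<close>; hence \<open>y \<le> l\<close> and \<open>w \<le> h\<close>.
  Conversely, under these two inequalities the L-shape is a minimum distance diagram of the
  quotient of \<open>\<int>\<^sup>2\<close> by the lattice spanned by \<open>(l, -y)\<close> and \<open>(-w, h)\<close>. The inequalities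
  are invariant under scaling.
\<close>

section \<open>Transport of diagrams along group isomorphisms\<close>

lemma two_cayley_digraph_iso:
  assumes "two_cayley_digraph G a b" and h: "h \<in> iso G H" and H: "group H"
  shows "two_cayley_digraph H (h a) (h b)"
proof -
  interpret G: two_cayley_digraph G a b by fact
  interpret h: group_hom G H h
    using h H G.is_group by (auto simp: group_hom_def group_hom_axioms_def iso_def)
  have inj: "inj_on h (carrier G)" and img: "h ` carrier G = carrier H"
    using h by (auto simp: iso_def bij_betw_def)
  have nontrivial: "h x \<in> carrier H - {\<one>\<^bsub>H\<^esub>}" if "x \<in> carrier G - {\<one>\<^bsub>G\<^esub>}" for x
    using that inj by (metis DiffD1 DiffD2 DiffI G.one_closed h.hom_closed h.hom_one inj_onD singletonD singletonI)
  have "comm_group H"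
    using G.iso_imp_comm_group[of H] h H by (auto simp: is_iso_def group.is_monoid)
  moreover have "generate H {h a, h b} = carrier H"
    using h.generate_img[of "{a, b}"] G.a_in G.b_in G.generates img by auto
  moreover have "finite (carrier H)"
    using G.finite_carrier img by (metis finite_imageI)
  ultimately show ?thesis
    using nontrivial[OF G.a_in] nontrivial[OF G.b_in]
    by (simp add: two_cayley_digraph_def two_cayley_digraph_axioms_def)
qed

text \<open>An isomorphism matches the pairs representing \<open>x\<close> with those representing
  \<open>h x\<close>, so \<open>\<psi>\<close> composed with the inverse of \<open>h\<close> is a
  diagram with the same image.\<close>

lemma is_mdd_of_iso:
  assumes S: "is_mdd_of S G a b" and h: "h \<in> iso G H" and H: "group H"
  shows "is_mdd_of S H (h a) (h b)"
proof -
  obtain \<psi> where G: "two_cayley_digraph G a b" and \<psi>: "min_dist_diagram G a b \<psi>"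
    and im: "S = \<psi> ` carrier G"
    using S unfolding is_mdd_of_def by blast
  interpret G: two_cayley_digraph G a b by fact
  interpret h: group_hom G H h
    using h H G.is_group by (auto simp: group_hom_def group_hom_axioms_def iso_def)
  have inj: "inj_on h (carrier G)" and img: "h ` carrier G = carrier H"
    using h by (auto simp: iso_def bij_betw_def)
  define g where "g = inv_into (carrier G) h"
  have g: "g (h x) = x" if "x \<in> carrier G" for x
    using inj that by (simp add: g_def)
  have rep: "h a [^]\<^bsub>H\<^esub> i \<otimes>\<^bsub>H\<^esub> h b [^]\<^bsub>H\<^esub> j = h x \<longleftrightarrow> a [^]\<^bsub>G\<^esub> i \<otimes>\<^bsub>G\<^esub> b [^]\<^bsub>G\<^esub> j = x"
    if "x \<in> carrier G" for x and i j :: nat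
  proof -
    have "a [^]\<^bsub>G\<^esub> i \<otimes>\<^bsub>G\<^esub> b [^]\<^bsub>G\<^esub> j \<in> carrier G"
      using G.a_in G.b_in by simp
    moreover have "h a [^]\<^bsub>H\<^esub> i \<otimes>\<^bsub>H\<^esub> h b [^]\<^bsub>H\<^esub> j = h (a [^]\<^bsub>G\<^esub> i \<otimes>\<^bsub>G\<^esub> b [^]\<^bsub>G\<^esub> j)"
      using G.a_in G.b_in by (simp add: h.hom_nat_pow)
    ultimately show ?thesis
      using inj that by (metis inj_onD)
  qed
  have "min_dist_diagram H (h a) (h b) (\<psi> \<circ> g)"
    using \<psi> unfolding min_dist_diagram_def img[symmetric] by (simp add: g rep)
  moreover have "S = (\<psi> \<circ> g) ` carrier H"
    unfolding im img[symmetric] by (force simp: g image_image)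
  ultimately show ?thesis
    using two_cayley_digraph_iso[OF G h H] by (auto simp: is_mdd_of_def)
qed

text \<open>A finite carrier injects into the natural numbers, and \<open>image_group\<close>
  carries the group structure along. This frees the constructions below from the element type fixed
  in \<open>is_mdd\<close>.\<close>

lemma is_mdd_of_imp_is_mdd:
  assumes "is_mdd_of S G a b"
  shows "is_mdd S"
proof -
  interpret G: two_cayley_digraph G a b
    using assms by (simp add: is_mdd_of_def)
  obtain e :: "_ \<Rightarrow> nat" where e: "inj_on e (carrier G)"
    using finite_imp_inj_to_nat_seg[OF G.finite_carrier] by blast
  have "e \<in> iso G (image_group e G)"
    using e by (rule inj_imp_image_group_iso)
  moreover have "group (image_group e G)"
    using e by (rule G.inj_imp_image_group_is_group)
  ultimately show ?thesis
    using is_mdd_of_iso[OF assms, of e] unfolding is_mdd_def by blast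
qed

section \<open>Diagrams as sets of unique shortest representatives\<close>

lemma (in group) inv_eq_nat_pow_finite:
  assumes "finite (carrier G)" and x: "x \<in> carrier G"
  shows "inv x = x [^] (order G - 1)"
proof (rule inv_equality)
  have "0 < order G"
    using assms by (auto simp: order_def card_gt_0_iff)
  then have "x [^] (order G - 1) \<otimes> x = x [^] order G"
    by (metis One_nat_def Suc_diff_1 nat_pow_Suc)
  then show "x [^] (order G - 1) \<otimes> x = \<one>"
    using x by (simp add: pow_order_eq_1)
qed (use x in auto)

text \<open>In a finite group inverses are powers with natural exponents, so the products on the
  right are already closed under inversion.\<close>

lemma (in comm_group) generate_pair_finite:
  assumes fin: "finite (carrier G)" and a: "a \<in> carrier G" and b: "b \<in> carrier G"
  shows "generate G {a, b} = {a [^] i \<otimes> b [^] j | (i::nat) (j::nat). True}" (is "_ = ?P")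
proof (rule generateI[symmetric])
  show "subgroup ?P G"
  proof (unfold_locales, goal_cases)
    case 1
    then show ?case using a b by auto
  next
    case (2 x y)
    then obtain i j i' j' :: nat where "x = a [^] i \<otimes> b [^] j" "y = a [^] i' \<otimes> b [^] j'"
      by auto
    then have "x \<otimes> y = a [^] (i + i') \<otimes> b [^] (j + j')"
      using a b by (simp add: m_ac flip: nat_pow_mult)
    then show ?case by blast
  next
    case 3
    have "\<one> = a [^] (0::nat) \<otimes> b [^] (0::nat)" by simp
    then show ?case by blast
  next
    case (4 x)
    then obtain i j :: nat where "x = a [^] i \<otimes> b [^] j"
      by auto
    then have "inv x = a [^] (i * (order G - 1)) \<otimes> b [^] (j * (order G - 1))"
      using a b by (simp add: inv_mult inv_eq_nat_pow_finite[OF fin] nat_pow_pow nat_pow_distrib)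
    then show ?case by blast
  qed
  have "a = a [^] (1::nat) \<otimes> b [^] (0::nat)" "b = a [^] (0::nat) \<otimes> b [^] (1::nat)"
    using a b by auto
  then show "{a, b} \<subseteq> ?P" by blast
  fix K assume K: "subgroup K G" "{a, b} \<subseteq> K"
  then have "a [^] n \<in> K" "b [^] n \<in> K" for n :: nat
    using K by (induction n) (auto intro: subgroup.m_closed subgroup.one_closed)
  then show "?P \<subseteq> K"
    using K(1) by (auto intro: subgroup.m_closed)
qed

text \<open>The function \<open>\<psi>\<close> is a section of the map sending a pair to its group
  element. Injectivity on the image follows, and the value of \<open>\<psi>\<close> at the element
  of \<open>(i, j)\<close> is the required representative.\<close>

lemma is_mdd_ofD:
  assumes "is_mdd_of S G a b"
  shows "inj_on (\<lambda>(i::nat, j::nat). a [^]\<^bsub>G\<^esub> i \<otimes>\<^bsub>G\<^esub> b [^]\<^bsub>G\<^esub> j) S"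
    and "\<exists>s t. (s, t) \<in> S \<and> a [^]\<^bsub>G\<^esub> s \<otimes>\<^bsub>G\<^esub> b [^]\<^bsub>G\<^esub> t = a [^]\<^bsub>G\<^esub> i \<otimes>\<^bsub>G\<^esub> b [^]\<^bsub>G\<^esub> j \<and> s + t \<le> i + j"
proof -
  obtain \<psi> where G: "two_cayley_digraph G a b" and \<psi>: "min_dist_diagram G a b \<psi>"
    and im: "S = \<psi> ` carrier G"
    using assms unfolding is_mdd_of_def by blast
  interpret G: two_cayley_digraph G a b by fact
  have *: "\<exists>i j. \<psi> x = (i, j) \<and> a [^]\<^bsub>G\<^esub> i \<otimes>\<^bsub>G\<^esub> b [^]\<^bsub>G\<^esub> j = x \<and>
      (\<forall>i' j'. a [^]\<^bsub>G\<^esub> (i'::nat) \<otimes>\<^bsub>G\<^esub> b [^]\<^bsub>G\<^esub> (j'::nat) = x \<longrightarrow> i + j \<le> i' + j')"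
    if "x \<in> carrier G" for x
    using \<psi> that unfolding min_dist_diagram_def by blast
  show "inj_on (\<lambda>(i::nat, j::nat). a [^]\<^bsub>G\<^esub> i \<otimes>\<^bsub>G\<^esub> b [^]\<^bsub>G\<^esub> j) S"
    unfolding im
  proof (rule inj_onI)
    fix p p' assume "p \<in> \<psi> ` carrier G" "p' \<in> \<psi> ` carrier G"
      and eq: "(case p of (i, j) \<Rightarrow> a [^]\<^bsub>G\<^esub> i \<otimes>\<^bsub>G\<^esub> b [^]\<^bsub>G\<^esub> j) =
       (case p' of (i, j) \<Rightarrow> a [^]\<^bsub>G\<^esub> i \<otimes>\<^bsub>G\<^esub> b [^]\<^bsub>G\<^esub> j)"
    then obtain x x' where x: "x \<in> carrier G" "p = \<psi> x" and x': "x' \<in> carrier G" "p' = \<psi> x'"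
      by blast
    obtain i j i' j' :: nat where ij: "p = (i, j)" "a [^]\<^bsub>G\<^esub> i \<otimes>\<^bsub>G\<^esub> b [^]\<^bsub>G\<^esub> j = x"
      "p' = (i', j')" "a [^]\<^bsub>G\<^esub> i' \<otimes>\<^bsub>G\<^esub> b [^]\<^bsub>G\<^esub> j' = x'"
      using *[OF x(1)] *[OF x'(1)] x(2) x'(2) by metis
    then have "x = x'" using eq by simp
    with x x' show "p = p'" by simp
  qed
  have "a [^]\<^bsub>G\<^esub> i \<otimes>\<^bsub>G\<^esub> b [^]\<^bsub>G\<^esub> j \<in> carrier G"
    using G.a_in G.b_in by simp
  from *[OF this] this
  show "\<exists>s t. (s, t) \<in> S \<and> a [^]\<^bsub>G\<^esub> s \<otimes>\<^bsub>G\<^esub> b [^]\<^bsub>G\<^esub> t = a [^]\<^bsub>G\<^esub> i \<otimes>\<^bsub>G\<^esub> b [^]\<^bsub>G\<^esub> j \<and> s + t \<le> i + j"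
    unfolding im by (metis image_eqI order_refl)
qed

lemma L_shape_iff:
  assumes "w < l" "y < h"
  shows "(i, j) \<in> L_shape l h w y \<longleftrightarrow> i < l \<and> j < h \<and> (i < l - w \<or> j < h - y)"
  using assms by (auto simp: L_shape_def)

text \<open>The removed block is empty; hence the other parameter of a rectangle can be chosen
  freely.\<close>

lemma L_shape_degenerate:
  "w = 0 \<or> y = 0 \<Longrightarrow> L_shape l h w y = L_shape l h 0 0"
  by (auto simp: L_shape_def)

text \<open>A converse to \<open>is_mdd_ofD\<close>, with \<open>\<psi>\<close> the inverse of
  \<open>f\<close> on \<open>S\<close>. Covering makes \<open>f\<close> map \<open>S\<close> onto
  the generated subgroup and, together with injectivity, makes each point of \<open>S\<close> a
  shortest representative. In that subgroup \<open>a\<close> and \<open>b\<close> generate by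
  construction.\<close>

lemma (in comm_group) is_mdd_of_subgroup_generated:
  fixes S :: "(nat \<times> nat) set"
  assumes fin: "finite (carrier G)"
    and a: "a \<in> carrier G - {\<one>}" and b: "b \<in> carrier G - {\<one>}"
    and down: "\<And>i j s t. (i, j) \<in> S \<Longrightarrow> s \<le> i \<Longrightarrow> t \<le> j \<Longrightarrow> (s, t) \<in> S"
    and inj: "inj_on (\<lambda>(i, j). a [^] i \<otimes> b [^] j) S"
    and cover: "\<And>i j :: nat. \<exists>s t. (s, t) \<in> S \<and> a [^] s \<otimes> b [^] t = a [^] i \<otimes> b [^] j \<and> s + t \<le> i + j"
  shows "is_mdd_of S (subgroup_generated G {a, b}) a b"
proof -
  define H where "H = subgroup_generated G {a, b}"
  define f where "f = (\<lambda>(i::nat, j::nat). a [^] i \<otimes> b [^] j)"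
  define \<psi> where "\<psi> = inv_into S f"
  have carr: "carrier H = generate G {a, b}"
    using a b by (auto simp: H_def carrier_subgroup_generated intro: arg_cong[where f = "generate G"])
  have f_img: "carrier H = f ` S"
  proof -
    have "carrier H = range f"
      unfolding carr using a b by (subst generate_pair_finite[OF fin]) (auto simp: f_def)
    also have "\<dots> = f ` S"
    proof (intro equalityI subsetI)
      fix x assume "x \<in> range f"
      then obtain i j where "x = f (i, j)" by auto
      with cover[of i j] show "x \<in> f ` S"
        by (auto simp: f_def image_iff Bex_def intro: sym)
    qed auto
    finally show ?thesis .
  qed
  have \<psi>: "\<psi> (f p) = p" if "p \<in> S" for p
    using inj that by (simp add: \<psi>_def f_def)
  have "two_cayley_digraph H a b"
  proof -
    have "comm_group H"
      unfolding H_def by (rule abelian_subgroup_generated) (rule comm_group_axioms)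
    moreover have "finite (carrier H)"
      using fin carrier_subgroup_generated_subset[of "{a, b}"] by (auto simp: H_def intro: finite_subset)
    moreover have "a \<in> carrier H" "b \<in> carrier H"
      unfolding carr by (auto intro: generate.incl)
    moreover have "generate H {a, b} = carrier H"
    proof -
      have "subgroup_generated H {a, b} = H" by (simp add: H_def)
      then have "generate H (carrier H \<inter> {a, b}) = carrier H"
        by (metis carrier_subgroup_generated)
      then show ?thesis
        using \<open>a \<in> carrier H\<close> \<open>b \<in> carrier H\<close> by simp
    qed
    ultimately show ?thesis
      using a b by (auto simp: two_cayley_digraph_def two_cayley_digraph_axioms_def H_def)
  qed
  moreover have "S = \<psi> ` carrier H"
    unfolding f_img by (force simp: \<psi> image_image)
  moreover have "min_dist_diagram H a b \<psi>"
    unfolding min_dist_diagram_def f_img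
  proof (intro conjI ballI)
    fix x assume "x \<in> f ` S"
    then obtain i j where ij: "(i, j) \<in> S" "x = f (i, j)" by auto
    have "i + j \<le> i' + j'" if "f (i', j') = x" for i' j'
    proof -
      obtain s t where st: "(s, t) \<in> S" "f (s, t) = f (i', j')" "s + t \<le> i' + j'"
        using cover[of i' j'] by (auto simp: f_def)
      then have "(s, t) = (i, j)"
        using ij that \<psi> by metis
      with st show ?thesis by simp
    qed
    then show "\<exists>i j. \<psi> x = (i, j) \<and> a [^]\<^bsub>H\<^esub> i \<otimes>\<^bsub>H\<^esub> b [^]\<^bsub>H\<^esub> j = x \<and>
        (\<forall>i' j'. a [^]\<^bsub>H\<^esub> (i'::nat) \<otimes>\<^bsub>H\<^esub> b [^]\<^bsub>H\<^esub> (j'::nat) = x \<longrightarrow> i + j \<le> i' + j')"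
      using \<psi>[OF ij(1)] ij(2)
      by (intro exI[of _ i] exI[of _ j]) (simp add: H_def pow_subgroup_generated f_def)
  next
    fix x assume "x \<in> f ` S"
    then obtain p where "p \<in> S" "\<psi> x = p"
      using \<psi> by auto
    then show "\<forall>s t. s \<le> fst (\<psi> x) \<and> t \<le> snd (\<psi> x) \<longrightarrow> (\<exists>\<gamma>\<in>f ` S. \<psi> \<gamma> = (s, t))"
      using \<psi> down by (metis image_eqI prod.collapse)
  qed
  ultimately show ?thesis
    unfolding is_mdd_of_def H_def by blast
qed

lemma pow_DirProd:
  "(x, y) [^]\<^bsub>G \<times>\<times> H\<^esub> (n::nat) = (x [^]\<^bsub>G\<^esub> n, y [^]\<^bsub>H\<^esub> n)"
  by (induction n) auto

section \<open>Necessity of the two inequalities\<close>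

lemma L_shape_mdd_bounds:
  assumes "w < l" "y < h" "0 < w" "0 < y"
    and mdd: "is_mdd_of (L_shape l h w y) G a b"
  shows "y \<le> l \<and> w \<le> h"
proof -
  interpret two_cayley_digraph G a b
    using mdd by (simp add: is_mdd_of_def)
  have a: "a \<in> carrier G" and b: "b \<in> carrier G"
    using a_in b_in by auto
  define f where "f = (\<lambda>(i::nat) (j::nat). a [^]\<^bsub>G\<^esub> i \<otimes>\<^bsub>G\<^esub> b [^]\<^bsub>G\<^esub> j)"
  have f_add: "f (i + i') (j + j') = f i j \<otimes>\<^bsub>G\<^esub> f i' j'" for i j i' j'
    using a b by (simp add: f_def m_ac flip: nat_pow_mult)
  have f_closed: "f i j \<in> carrier G" for i j
    using a b by (simp add: f_def)
  have f_cancel: "f (i + k) (j + n) = f (i' + k) (j' + n) \<longleftrightarrow> f i j = f i' j'" for i j i' j' k n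
    by (simp add: f_add f_closed)
  have inj: "i = i' \<and> j = j'"
    if "(i, j) \<in> L_shape l h w y" "(i', j') \<in> L_shape l h w y" "f i j = f i' j'" for i j i' j'
    using is_mdd_ofD(1)[OF mdd] that by (force simp: f_def inj_on_def)
  have cover: "\<exists>s t. (s, t) \<in> L_shape l h w y \<and> f s t = f i j \<and> s + t \<le> i + j" for i j
    using is_mdd_ofD(2)[OF mdd] by (simp add: f_def)
  \<comment> \<open>Here \<open>c = l - w - 1\<close> and \<open>d = h - y - 1\<close>, so
    \<open>(Suc c, Suc d)\<close> is the inner corner, written without truncated
    subtraction.\<close>
  obtain c d where l: "l = Suc (w + c)" and h: "h = Suc (y + d)"
    using assms less_imp_Suc_add by meson
  have L: "(i, j) \<in> L_shape l h w y \<longleftrightarrow> i \<le> w + c \<and> j \<le> y + d \<and> (i \<le> c \<or> j \<le> d)" for i j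
    using assms by (auto simp: L_shape_iff l h)
  \<comment> \<open>A point just right of the shape is represented on the vertical axis: if
    \<open>s > 0\<close>, cancelling one \<open>a\<close> leaves two points of the shape with equal
    value, so \<open>(s, t)\<close> would be the outside point itself.\<close>
  have left: "s = 0"
    if "(s, t) \<in> L_shape l h w y" "f s t = f (Suc i) j"
      "(i, j) \<in> L_shape l h w y" "(Suc i, j) \<notin> L_shape l h w y" for s t i j
  proof (cases s)
    case (Suc s')
    then have "f s' t = f i j"
      using that(2) f_cancel[of s' 1 t 0 i j] by simp
    moreover have "(s', t) \<in> L_shape l h w y"
      using that(1) unfolding Suc L by linarith
    ultimately show ?thesis
      using inj that Suc by blast
  qed
  have below: "t = 0"
    if "(s, t) \<in> L_shape l h w y" "f s t = f i (Suc j)"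
      "(i, j) \<in> L_shape l h w y" "(i, Suc j) \<notin> L_shape l h w y" for s t i j
  proof (cases t)
    case (Suc t')
    then have "f s t' = f i j"
      using that(2) f_cancel[of s 0 t' 1 i j] by simp
    moreover have "(s, t') \<in> L_shape l h w y"
      using that(1) unfolding Suc L by linarith
    ultimately show ?thesis
      using inj that Suc by blast
  qed
  \<comment> \<open>As \<open>w\<close> and \<open>y\<close> are positive, the left and lower
    neighbours of the corner lie in the shape, so its representative is on both axes.\<close>
  obtain s t where st: "(s, t) \<in> L_shape l h w y" "f s t = f (Suc c) (Suc d)"
    using cover by blast
  have "s = 0"
    using left[OF st] assms by (simp add: L)
  moreover have "t = 0"
    using below[OF st] assms by (simp add: L)
  ultimately have corner: "f (Suc c) (Suc d) = f 0 0"
    using st by simp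
  have "y \<le> l"
  proof -
    obtain s t where st: "(s, t) \<in> L_shape l h w y" "f s t = f (Suc (w + c)) 0" "s + t \<le> l"
      using cover[of "Suc (w + c)" 0] by (auto simp: l)
    have "s = 0"
      using left[OF st(1,2)] assms by (simp add: L)
    \<comment> \<open>Subtracting the corner relation from \<open>(l, -t)\<close> leaves
      \<open>(w, -(h - y + t))\<close>. Both sides are shifted by \<open>(Suc c, Suc d)\<close>
      because exponents are natural numbers; \<open>f_cancel\<close> removes the shift.\<close>
    have "f (0 + Suc c) (Suc d + t + Suc d) = f (Suc c) (Suc d) \<otimes>\<^bsub>G\<^esub> f 0 (Suc d + t)"
      by (simp add: add_ac flip: f_add)
    also have "\<dots> = f 0 t \<otimes>\<^bsub>G\<^esub> f 0 (Suc d)"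
      unfolding corner by (simp add: add_ac flip: f_add)
    also have "\<dots> = f (w + Suc c) (0 + Suc d)"
      using st(2) \<open>s = 0\<close> by (simp flip: f_add)
    finally have eq: "f 0 (Suc d + t) = f w 0"
      unfolding f_cancel .
    show ?thesis
    proof (rule ccontr)
      assume "\<not> y \<le> l"
      \<comment> \<open>For \<open>t < y\<close> the distinct points \<open>(0, Suc d + t)\<close>
        and \<open>(w, 0)\<close> both lie in the shape; hence
        \<open>y \<le> t \<le> l\<close>.\<close>
      then have "t < y" using st by simp
      then show False
        using inj[OF _ _ eq] assms by (simp add: L)
    qed
  qed
  moreover have "w \<le> h"
  proof -
    obtain s t where st: "(s, t) \<in> L_shape l h w y" "f s t = f 0 (Suc (y + d))" "s + t \<le> h"
      using cover[of 0 "Suc (y + d)"] by (auto simp: h)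
    have "t = 0"
      using below[OF st(1,2)] assms by (simp add: L)
    have "f (Suc c + s + Suc c) (0 + Suc d) = f (Suc c) (Suc d) \<otimes>\<^bsub>G\<^esub> f (Suc c + s) 0"
      by (simp add: add_ac flip: f_add)
    also have "\<dots> = f s 0 \<otimes>\<^bsub>G\<^esub> f (Suc c) 0"
      unfolding corner by (simp add: add_ac flip: f_add)
    also have "\<dots> = f (0 + Suc c) (y + Suc d)"
      using st(2) \<open>t = 0\<close> by (simp flip: f_add)
    finally have eq: "f (Suc c + s) 0 = f 0 y"
      unfolding f_cancel .
    show ?thesis
    proof (rule ccontr)
      assume "\<not> w \<le> h"
      then have "s < w" using st by simp
      then show False
        using inj[OF _ _ eq] assms by (simp add: L)
    qed
  qed
  ultimately show ?thesis ..
qed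

section \<open>The lattice, with the L-shape as a fundamental domain\<close>

text \<open>Membership of \<open>(u, v)\<close> in the lattice spanned by \<open>(l, -y)\<close> and \<open>(-w, h)\<close>.\<close>

definition L_cong :: "nat \<Rightarrow> nat \<Rightarrow> nat \<Rightarrow> nat \<Rightarrow> int \<Rightarrow> int \<Rightarrow> bool" where
  "L_cong l h w y u v \<longleftrightarrow> (\<exists>p q. u = int l * p - int w * q \<and> v = int h * q - int y * p)"

lemma L_cong_diff:
  "L_cong l h w y u v \<Longrightarrow> L_cong l h w y u' v' \<Longrightarrow> L_cong l h w y (u - u') (v - v')"
  unfolding L_cong_def
proof (elim exE conjE)
  fix p q p' q'
  assume "u = int l * p - int w * q" "v = int h * q - int y * p"
    "u' = int l * p' - int w * q'" "v' = int h * q' - int y * p'"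
  then show "\<exists>p q. u - u' = int l * p - int w * q \<and> v - v' = int h * q - int y * p"
    by (intro exI[of _ "p - p'"] exI[of _ "q - q'"]) (simp add: algebra_simps)
qed

text \<open>
  A point outside the L-shape is moved by \<open>-(l, -y)\<close>, \<open>-(-w, h)\<close> or their sum. The weights
  \<open>h + y\<close> and \<open>w + l\<close> are the column sums of the adjugate of the lattice matrix, so that
  the first two moves lower the induction measure by exactly the area \<open>l h - w y\<close>.
\<close>

lemma L_shape_reduce:
  assumes "w < l" "y < h" "y \<le> l" "w \<le> h"
  shows "\<exists>s t. (s, t) \<in> L_shape l h w y \<and> L_cong l h w y (int i - int s) (int j - int t) \<and> s + t \<le> i + j"
proof (induction "(h + y) * i + (w + l) * j" arbitrary: i j rule: less_induct)
  case less
  \<comment> \<open>It suffices to move by a lattice vector that lowers the measure without raising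
    the coordinate sum.\<close>
  have step: ?case
    if smaller: "(h + y) * i' + (w + l) * j' < (h + y) * i + (w + l) * j" and sum: "i' + j' \<le> i + j"
      and cong: "L_cong l h w y (int i' - int i) (int j' - int j)" for i' j'
  proof -
    obtain s t where st: "(s, t) \<in> L_shape l h w y" "s + t \<le> i' + j'"
      "L_cong l h w y (int i' - int s) (int j' - int t)"
      using less.hyps[OF smaller] by blast
    have "L_cong l h w y (int i - int s) (int j - int t)"
      using L_cong_diff[OF st(3) cong] by simp
    then show ?thesis using st sum by fastforce
  qed
  have area: "w * y < l * h"
    using assms by (intro mult_strict_mono) auto
  show ?case
  proof (cases "(i, j) \<in> L_shape l h w y")
    case True
    moreover have "L_cong l h w y 0 0"
      unfolding L_cong_def by (intro exI[of _ 0]) simp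
    ultimately show ?thesis by fastforce
  next
    case False
    then consider "l \<le> i" | "h \<le> j" | "l - w \<le> i" "h - y \<le> j"
      using assms by (auto simp: L_shape_iff)
    then show ?thesis
    proof cases
      case 1
      then obtain k where k: "i = l + k" by (metis le_iff_add)
      \<comment> \<open>This move changes the coordinate sum by \<open>y - l\<close>, which is where
        \<open>y \<le> l\<close> enters; the next case uses \<open>w \<le> h\<close> in the same
        way.\<close>
      show ?thesis
      proof (rule step[of k "j + y"])
        show "L_cong l h w y (int k - int i) (int (j + y) - int j)"
          unfolding L_cong_def k by (intro exI[of _ "-1"] exI[of _ 0]) simp
      qed (use k assms area in \<open>simp_all add: algebra_simps\<close>)
    next
      case 2
      then obtain k where k: "j = h + k" by (metis le_iff_add)
      show ?thesis
      proof (rule step[of "i + w" k])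
        show "L_cong l h w y (int (i + w) - int i) (int k - int j)"
          unfolding L_cong_def k by (intro exI[of _ "0"] exI[of _ "-1"]) simp
      qed (use k assms area in \<open>simp_all add: algebra_simps\<close>)
    next
      case 3
      show ?thesis
      proof (rule step[of "i - (l - w)" "j - (h - y)"])
        show "L_cong l h w y (int (i - (l - w)) - int i) (int (j - (h - y)) - int j)"
          unfolding L_cong_def using 3 assms by (intro exI[of _ "-1"]) (simp add: of_nat_diff)
        have "(h + y) * (i - (l - w)) < (h + y) * i"
          using 3 assms by (intro mult_strict_left_mono) auto
        moreover have "(w + l) * (j - (h - y)) \<le> (w + l) * j"
          by (intro mult_left_mono) auto
        ultimately show "(h + y) * (i - (l - w)) + (w + l) * (j - (h - y)) < (h + y) * i + (w + l) * j"
          by linarith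
      qed simp
    qed
  qed
qed

text \<open>Let the difference be \<open>p (l, -y) + q (-w, h)\<close> with \<open>p\<close> or
  \<open>q\<close> positive. If \<open>p > q\<close>, its first coordinate is at least
  \<open>l\<close>; if \<open>q > p\<close>, its second is at least \<open>h\<close>; if
  \<open>p = q\<close>, it is at least \<open>(l - w, h - y)\<close> in both, which puts the first
  point into the removed corner.\<close>

lemma L_shape_cong_unique:
  assumes "w < l" "y < h" "(i, j) \<in> L_shape l h w y" "(s, t) \<in> L_shape l h w y"
    and "L_cong l h w y (int i - int s) (int j - int t)"
  shows "i = s \<and> j = t"
proof -
  have no_pos: False
    if L: "(i, j) \<in> L_shape l h w y" "(s, t) \<in> L_shape l h w y"
      and eq: "int i - int s = int l * p - int w * q" "int j - int t = int h * q - int y * p"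
      and pos: "0 < p \<or> 0 < q" for i j s t p q
  proof -
    have bounds: "int i - int s < int l" "int j - int t < int h"
      using L assms by (auto simp: L_shape_iff)
    have p: "p \<le> q"
    proof (rule ccontr)
      assume "\<not> p \<le> q"
      then have "p \<ge> 1" "p \<ge> q + 1" using pos by auto
      \<comment> \<open>For \<open>q \<le> 0\<close> the subtracted term is nonpositive; for
        \<open>q > 0\<close> it is at most \<open>l q\<close>, and \<open>l p\<close> exceeds that
        by at least \<open>l\<close>.\<close>
      have "int l * 1 \<le> int l * p - int w * q"
      proof (cases "q \<le> 0")
        case True
        then have "int w * q \<le> 0" by (simp add: mult_nonneg_nonpos)
        moreover have "int l * 1 \<le> int l * p" using \<open>p \<ge> 1\<close> by (intro mult_left_mono) auto
        ultimately show ?thesis by linarith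
      next
        case False
        have "int l * (q + 1) \<le> int l * p" using \<open>p \<ge> q + 1\<close> by (intro mult_left_mono) auto
        moreover have "int w * q \<le> int l * q" using False assms by (intro mult_right_mono) auto
        ultimately show ?thesis by (simp add: algebra_simps)
      qed
      then show False using bounds eq by simp
    qed
    have q: "q \<le> p"
    proof (rule ccontr)
      assume "\<not> q \<le> p"
      then have "q \<ge> 1" "q \<ge> p + 1" using pos by auto
      have "int h * 1 \<le> int h * q - int y * p"
      proof (cases "p \<le> 0")
        case True
        then have "int y * p \<le> 0" by (simp add: mult_nonneg_nonpos)
        moreover have "int h * 1 \<le> int h * q" using \<open>q \<ge> 1\<close> by (intro mult_left_mono) auto
        ultimately show ?thesis by linarith
      next
        case False
        have "int h * (p + 1) \<le> int h * q" using \<open>q \<ge> p + 1\<close> by (intro mult_left_mono) auto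
        moreover have "int y * p \<le> int h * p" using False assms by (intro mult_right_mono) auto
        ultimately show ?thesis by (simp add: algebra_simps)
      qed
      then show False using bounds eq by simp
    qed
    have "p = q" "p \<ge> 1" using p q pos by auto
    then have "(int l - int w) * 1 \<le> (int l - int w) * p" "(int h - int y) * 1 \<le> (int h - int y) * p"
      using assms by (auto intro!: mult_left_mono simp del: mult_1_right)
    then have "l - w \<le> i" "h - y \<le> j"
      using eq \<open>p = q\<close> by (auto simp: algebra_simps)
    then show False using L assms by (auto simp: L_shape_iff)
  qed
  obtain p q where eq: "int i - int s = int l * p - int w * q" "int j - int t = int h * q - int y * p"
    using assms(5) by (auto simp: L_cong_def)
  have "\<not> (0 < p \<or> 0 < q)"
    using no_pos[OF assms(3,4) eq] by blast
  \<comment> \<open>Exchanging the two points negates both coefficients, so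
    \<open>p = q = 0\<close>.\<close>
  moreover have "\<not> (0 < - p \<or> 0 < - q)"
    using no_pos[OF assms(4,3), of "- p" "- q"] eq by auto
  ultimately show ?thesis using eq by auto
qed

text \<open>Cramer's rule: the adjugate times the lattice matrix is \<open>N\<close> times the
  identity, so \<open>(u, v)\<close> is in the lattice iff its image under the adjugate is divisible
  by \<open>N\<close>. Membership thus becomes a pair of congruences modulo
  \<open>N\<close>.\<close>

lemma L_cong_iff:
  assumes "w < l" "y < h"
  defines "N \<equiv> int (l * h - w * y)"
  shows "L_cong l h w y u v \<longleftrightarrow> N dvd int h * u + int w * v \<and> N dvd int y * u + int l * v"
proof -
  have area: "w * y < l * h"
    using assms by (intro mult_strict_mono) auto
  then have "N \<noteq> 0"
    unfolding N_def of_nat_eq_0_iff by linarith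
  have N: "N = int l * int h - int w * int y"
    using area by (simp add: N_def of_nat_diff)
  show ?thesis
  proof
    assume "L_cong l h w y u v"
    then obtain p q where "u = int l * p - int w * q" "v = int h * q - int y * p"
      by (auto simp: L_cong_def)
    then have "int h * u + int w * v = N * p" "int y * u + int l * v = N * q"
      by (simp_all add: N ring_distribs mult_ac)
    then show "N dvd int h * u + int w * v \<and> N dvd int y * u + int l * v"
      by simp
  next
    assume "N dvd int h * u + int w * v \<and> N dvd int y * u + int l * v"
    then obtain p q where pq: "int h * u + int w * v = N * p" "int y * u + int l * v = N * q"
      by (auto elim!: dvdE)
    have "N * u = int l * (int h * u + int w * v) - int w * (int y * u + int l * v)"
      "N * v = int h * (int y * u + int l * v) - int y * (int h * u + int w * v)"
      by (auto simp: N algebra_simps)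
    then have "N * u = N * (int l * p - int w * q)" "N * v = N * (int h * q - int y * p)"
      unfolding pq by (auto simp: algebra_simps)
    then show "L_cong l h w y u v"
      using \<open>N \<noteq> 0\<close> unfolding L_cong_def by auto
  qed
qed

section \<open>Realisation of the L-shape by a finite group\<close>

text \<open>
  The quotient by the lattice is realised inside the square of the integers modulo its determinant
  \<open>N\<close>, by means of the adjugate matrix; its columns are the generators. The last two hypotheses
  exclude trivial generators.
\<close>

lemma is_mdd_L_shape:
  assumes "w < l" "y < h" "y \<le> l" "w \<le> h" and nt: "1 < l + y" "1 < h + w"
  shows "is_mdd (L_shape l h w y)"
proof -
  define N where "N = l * h - w * y"
  define Z where "Z = integer_mod_group N"
  define a where "a = (int h mod int N, int y mod int N)"
  define b where "b = (int w mod int N, int l mod int N)"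
  have "w * y < l * h"
    using assms by (intro mult_strict_mono) auto
  then have N: "N > 0" by (simp add: N_def)
  interpret Z: comm_group Z by (simp add: Z_def)
  interpret ZZ: comm_group "Z \<times>\<times> Z"
  proof (rule group.group_comm_groupI)
    show "group (Z \<times>\<times> Z)" by (intro DirProd_group) (rule Z.is_group)+
  qed (auto simp: Z.m_comm)
  have rep: "a [^]\<^bsub>Z \<times>\<times> Z\<^esub> i \<otimes>\<^bsub>Z \<times>\<times> Z\<^esub> b [^]\<^bsub>Z \<times>\<times> Z\<^esub> j =
      ((int h * int i + int w * int j) mod int N, (int y * int i + int l * int j) mod int N)" for i j :: nat
    by (simp add: a_def b_def pow_DirProd Z_def mod_simps algebra_simps)
  have rep_eq: "a [^]\<^bsub>Z \<times>\<times> Z\<^esub> i \<otimes>\<^bsub>Z \<times>\<times> Z\<^esub> b [^]\<^bsub>Z \<times>\<times> Z\<^esub> j =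
      a [^]\<^bsub>Z \<times>\<times> Z\<^esub> s \<otimes>\<^bsub>Z \<times>\<times> Z\<^esub> b [^]\<^bsub>Z \<times>\<times> Z\<^esub> t \<longleftrightarrow> L_cong l h w y (int i - int s) (int j - int t)"
    for i j s t :: nat
    unfolding rep L_cong_iff[OF assms(1,2)]
    by (simp add: mod_eq_dvd_iff N_def algebra_simps)
  have carr: "a \<in> carrier (Z \<times>\<times> Z)" "b \<in> carrier (Z \<times>\<times> Z)"
    using N by (auto simp: a_def b_def Z_def carrier_integer_mod_group)
  have "a \<noteq> \<one>\<^bsub>Z \<times>\<times> Z\<^esub>"
  proof
    assume "a = \<one>\<^bsub>Z \<times>\<times> Z\<^esub>"
    then have *: "L_cong l h w y 1 0"
      using rep_eq[of 1 0 0 0] carr by simp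
    \<comment> \<open>For \<open>l > 1\<close> the point \<open>(1, 0)\<close> lies in the shape and
      cannot be congruent to the origin. For \<open>l = 1\<close> it lies outside, but then
      \<open>w = 0\<close> and \<open>y = 1\<close>, and the relation forces \<open>h = 1\<close>,
      against \<open>1 < h + w\<close>.\<close>
    show False
    proof (cases "l = 1")
      case True
      then have "w = 0" "y = 1" using assms by auto
      with * True obtain q where "int h * q = 1" by (auto simp: L_cong_def)
      then have "h = 1" by (simp add: zmult_eq_1_iff)
      then show False using nt \<open>w = 0\<close> by simp
    next
      case False
      then show False
        using L_shape_cong_unique[of w l y h 1 0 0 0] * assms by (auto simp: L_shape_iff)
    qed
  qed
  moreover have "b \<noteq> \<one>\<^bsub>Z \<times>\<times> Z\<^esub>"
  proof
    assume "b = \<one>\<^bsub>Z \<times>\<times> Z\<^esub>"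
    then have *: "L_cong l h w y 0 1"
      using rep_eq[of 0 1 0 0] carr by simp
    show False
    proof (cases "h = 1")
      case True
      then have "y = 0" "w = 1" using assms by auto
      with * True obtain p where "int l * p = 1" by (auto simp: L_cong_def)
      then have "l = 1" by (simp add: zmult_eq_1_iff)
      then show False using nt \<open>y = 0\<close> by simp
    next
      case False
      then show False
        using L_shape_cong_unique[of w l y h 0 1 0 0] * assms by (auto simp: L_shape_iff)
    qed
  qed
  ultimately have "is_mdd_of (L_shape l h w y) (subgroup_generated (Z \<times>\<times> Z) {a, b}) a b"
  proof (intro ZZ.is_mdd_of_subgroup_generated)
    show "finite (carrier (Z \<times>\<times> Z))"
      using N by (simp add: Z_def carrier_integer_mod_group)
    show "inj_on (\<lambda>(i::nat, j::nat). a [^]\<^bsub>Z \<times>\<times> Z\<^esub> i \<otimes>\<^bsub>Z \<times>\<times> Z\<^esub> b [^]\<^bsub>Z \<times>\<times> Z\<^esub> j) (L_shape l h w y)"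
      using L_shape_cong_unique[OF assms(1,2)] by (auto simp: inj_on_def rep_eq)
    show "\<exists>s t. (s, t) \<in> L_shape l h w y \<and>
        a [^]\<^bsub>Z \<times>\<times> Z\<^esub> s \<otimes>\<^bsub>Z \<times>\<times> Z\<^esub> b [^]\<^bsub>Z \<times>\<times> Z\<^esub> t =
        a [^]\<^bsub>Z \<times>\<times> Z\<^esub> i \<otimes>\<^bsub>Z \<times>\<times> Z\<^esub> b [^]\<^bsub>Z \<times>\<times> Z\<^esub> j \<and> s + t \<le> i + j" for i j :: nat
      using L_shape_reduce[OF assms(1-4), of i j] by (metis rep_eq)
  qed (use carr assms in \<open>auto simp: L_shape_iff\<close>)
  then show ?thesis by (rule is_mdd_of_imp_is_mdd)
qed

section \<open>Rectangles, and stability under scaling\<close>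

text \<open>If \<open>l = 1\<close>, the lattice for \<open>w = y = 0\<close> contains
  \<open>(1, 0)\<close> and would make \<open>a\<close> trivial. Taking \<open>y = 1\<close> instead
  leaves the set unchanged and gives the cyclic group of order \<open>h\<close> with
  \<open>a = b\<close>; the case \<open>h = 1\<close> is symmetric.\<close>

lemma is_mdd_rectangle:
  assumes "0 < l" "0 < h" "\<not> (l = 1 \<and> h = 1)"
  shows "is_mdd (L_shape l h 0 0)"
proof -
  consider "l = 1" "1 < h" | "h = 1" "1 < l" | "1 < l" "1 < h"
    using assms by linarith
  then show ?thesis
  proof cases
    case 1
    then have "is_mdd (L_shape l h 0 1)"
      by (intro is_mdd_L_shape) auto
    then show ?thesis by (metis L_shape_degenerate)
  next
    case 2
    then have "is_mdd (L_shape l h 1 0)"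
      by (intro is_mdd_L_shape) auto
    then show ?thesis by (metis L_shape_degenerate)
  next
    case 3
    then show ?thesis by (intro is_mdd_L_shape) auto
  qed
qed

theorem theorem2:
  fixes G :: "('g, 'x) monoid_scheme" and a b :: 'g and l h w y m :: nat
  assumes "w < l" and "y < h"
    and "is_mdd_of (L_shape l h w y) G a b"
    and "m \<ge> 1"
  shows "is_mdd (L_shape (m * l) (m * h) (m * w) (m * y)) \<and>
    (m dvd Gcd {l, h, w, y} \<and> \<not> (l = m \<and> h = m) \<longrightarrow>
       is_mdd (L_shape (l div m) (h div m) (w div m) (y div m)))"
proof (cases "w = 0 \<or> y = 0")
  case True
  \<comment> \<open>The unit square is not a diagram, and positive multiples of any other rectangle
    are never the unit square.\<close>
  then have "\<not> (l = 1 \<and> h = 1)"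
    using assms(3) unit_square_not_mdd_of by (metis L_shape_degenerate)
  then have "is_mdd (L_shape (m * l) (m * h) 0 0)"
    using assms by (intro is_mdd_rectangle) auto
  moreover have "is_mdd (L_shape (l div m) (h div m) 0 0)"
    if "m dvd Gcd {l, h, w, y}" "\<not> (l = m \<and> h = m)"
  proof -
    have "m dvd l" "m dvd h" using that by simp_all
    then obtain l' h' where "l = m * l'" "h = m * h'" by (meson dvdE)
    then show ?thesis
      using that assms by (intro is_mdd_rectangle) auto
  qed
  moreover have "m * w = 0 \<or> m * y = 0" "w div m = 0 \<or> y div m = 0"
    using True by auto
  ultimately show ?thesis by (metis L_shape_degenerate)
next
  case False
  then have bounds: "y \<le> l" "w \<le> h" "0 < w" "0 < y"
    using L_shape_mdd_bounds[OF assms(1,2) _ _ assms(3)] by auto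
  \<comment> \<open>Positive \<open>w < l\<close> and \<open>y < h\<close> already give
    \<open>1 < l + y\<close> and \<open>1 < h + w\<close>. The other inequalities are homogeneous,
    so they survive multiplication and exact division by \<open>m\<close>.\<close>
  have scale: "is_mdd (L_shape l h w y)" if "w < l" "y < h" "y \<le> l" "w \<le> h" "0 < w" "0 < y" for l h w y
    using that by (intro is_mdd_L_shape) auto
  have "is_mdd (L_shape (m * l) (m * h) (m * w) (m * y))"
    using assms bounds by (intro scale) auto
  moreover have "is_mdd (L_shape (l div m) (h div m) (w div m) (y div m))"
    if dvd: "m dvd Gcd {l, h, w, y}"
  proof -
    have "m dvd l" "m dvd h" "m dvd w" "m dvd y" using dvd by simp_all
    then obtain l' h' w' y' where "l = m * l'" "h = m * h'" "w = m * w'" "y = m * y'"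
      by (meson dvdE)
    then show ?thesis
      using assms bounds by (intro scale) auto
  qed
  ultimately show ?thesis by blast
qed

end
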